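(* There is a universal constant $c>0$ such that the following holds. For any horizon $H\ge 2$ and any $K\ge 1$, there exists a family $\mathcal M$ of MDPs with horizon $H$, common state spaces $\{S_h\}_{h\le H}$ with $|S_h|\le 2$, common action spaces $\{A_h\}_{h\le H}$ with $|A_h|\le 2$, common initial state $s_0$, and rewards $r_h\in[0,1]$, such that for any algorithm that deploys policy $\mu^k$ in episode $k$, $$\sup_{M_1,\dots,M_K\in\mathcal M}\ \sup_{\mu}\ \sum_{k=1}^K\Bigl(V^{\mu}_{M_k}(s_0)-\mathbb E_{\mu^k}V^{\mu^k}_{M_k}(s_0)\Bigr)\ \ge\ c\,\min\bigl\{\sqrt{2^HK},\,K\bigr\}.$$
   Context: Setting (episodic MDPs with adversarially chosen transitions and rewards, bandit feedback): there are $K$ episodes; in episode $k$ the learner faces an MDP $M_k\in\mathcal M$ chosen by an adversary, whose transition function and reward function may change from episode to episode. All MDPs in $\mathcal M$ share the same layered state spaces $S_h$, action spaces $A_h$, horizon $H$ and deterministic initial state $s_0$. Rewards lie in $[0,1]$ and may be random given the state and action. A policy $\mu$ maps, at each step $h$, the current state in $S_h$ to a probability distribution over $A_h$. $V^{\mu}_{M}(s_0)$ is the expected cumulative reward over the $H$ steps of an episode when following $\mu$ in the MDP $M$ starting from $s_0$. The supremum over $\mu$ is over such fixed policies (the best policy in hindsight). An algorithm chooses (possibly at random) the policy $\mu^k$ before episode $k$ based only on the states, actions and rewards observed along the trajectories of episodes $1,\dots,k-1$; it does not observe $M_k$ itself. $\mathbb E_{\mu^k}$ denotes the expectation over the randomness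 in the algorithm's execution (including the realized transitions and rewards it used to determine $\mu^k$). *)

theory Defs
  imports "HOL-Probability.Probability"
begin

section \<open>Layered episodic MDPs\<close>

text \<open>
  Steps are numbered \<open>1, \<dots>, H\<close>. The family \<open>S\<close> of state spaces and the family \<open>A\<close> of action
  spaces are indexed by the step.  An MDP is given by its transition kernels
  \<open>trans M h s a\<close> (the law of the state at step \<open>h + 1\<close>) and by the laws \<open>reward M h s a\<close> of
  the random reward at step \<open>h\<close>.  Reward laws are discrete; this only restricts the MDPs the
  adversary may use.
\<close>

record ('s, 'a) mdp =
  trans :: "nat \<Rightarrow> 's \<Rightarrow> 'a \<Rightarrow> 's pmf"
  reward :: "nat \<Rightarrow> 's \<Rightarrow> 'a \<Rightarrow> real pmf"

definition is_mdp :: "nat \<Rightarrow> (nat \<Rightarrow> 's set) \<Rightarrow> (nat \<Rightarrow> 'a set) \<Rightarrow> ('s, 'a) mdp \<Rightarrow> bool" where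
  "is_mdp H S A M \<longleftrightarrow>
     (\<forall>h\<in>{1..<H}. \<forall>s\<in>S h. \<forall>a\<in>A h. set_pmf (trans M h s a) \<subseteq> S (Suc h)) \<and>
     (\<forall>h\<in>{1..H}. \<forall>s\<in>S h. \<forall>a\<in>A h. set_pmf (reward M h s a) \<subseteq> {0..1})"

type_synonym ('s, 'a) policy = "nat \<Rightarrow> 's \<Rightarrow> 'a pmf"

definition is_policy :: "nat \<Rightarrow> (nat \<Rightarrow> 's set) \<Rightarrow> (nat \<Rightarrow> 'a set) \<Rightarrow> ('s, 'a) policy \<Rightarrow> bool" where
  "is_policy H S A \<mu> \<longleftrightarrow> (\<forall>h\<in>{1..H}. \<forall>s\<in>S h. set_pmf (\<mu> h s) \<subseteq> A h)"

type_synonym ('s, 'a) trajectory = "('s \<times> 'a \<times> real) list"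

text \<open>
  \<open>rollout M \<mu> n h s\<close> is the law of the next \<open>n\<close> triples (state, action, reward) when \<open>\<mu>\<close> is
  followed in \<open>M\<close> from state \<open>s\<close> at step \<open>h\<close>.  The state drawn after the last step is discarded,
  so the transition kernel at step \<open>H\<close> has no influence.
\<close>

primrec rollout ::
    "('s, 'a) mdp \<Rightarrow> ('s, 'a) policy \<Rightarrow> nat \<Rightarrow> nat \<Rightarrow> 's \<Rightarrow> ('s, 'a) trajectory pmf" where
  "rollout M \<mu> 0 h s = return_pmf []"
| "rollout M \<mu> (Suc n) h s = do {
     a \<leftarrow> \<mu> h s;
     r \<leftarrow> reward M h s a;
     s' \<leftarrow> trans M h s a;
     \<tau> \<leftarrow> rollout M \<mu> n (Suc h) s';
     return_pmf ((s, a, r) # \<tau>)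
   }"

definition episode ::
    "nat \<Rightarrow> 's \<Rightarrow> ('s, 'a) mdp \<Rightarrow> ('s, 'a) policy \<Rightarrow> ('s, 'a) trajectory pmf" where
  "episode H s0 M \<mu> = rollout M \<mu> H 1 s0"

definition policy_value :: "nat \<Rightarrow> 's \<Rightarrow> ('s, 'a) mdp \<Rightarrow> ('s, 'a) policy \<Rightarrow> real" where
  "policy_value H s0 M \<mu> =
     measure_pmf.expectation (episode H s0 M \<mu>) (\<lambda>\<tau>. \<Sum>(s, a, r)\<leftarrow>\<tau>. r)"


section \<open>Learning algorithms under bandit feedback\<close>

text \<open>
  A deterministic algorithm maps the list of trajectories observed in the previous episodes to
  the policy deployed in the next one.  A randomized algorithm is a probability measure on
  deterministic algorithms: all internal randomness is drawn once, before the first episode.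
  This covers any source of internal randomness (push it forward along the map that sends a
  seed to the resulting deterministic algorithm), without fixing a type of seeds.
  The sigma-algebra is arbitrary, as long as the action probabilities are measurable.
\<close>

type_synonym ('s, 'a) det_algorithm = "('s, 'a) trajectory list \<Rightarrow> ('s, 'a) policy"

definition is_algorithm ::
    "nat \<Rightarrow> (nat \<Rightarrow> 's set) \<Rightarrow> (nat \<Rightarrow> 'a set) \<Rightarrow> ('s, 'a) det_algorithm measure \<Rightarrow> bool" where
  "is_algorithm H S A \<A> \<longleftrightarrow>
     prob_space \<A> \<and>
     (\<forall>\<alpha>\<in>space \<A>. \<forall>hist. is_policy H S A (\<alpha> hist)) \<and>
     (\<forall>hist. \<forall>h\<in>{1..H}. \<forall>s\<in>S h. \<forall>a\<in>A h. (\<lambda>\<alpha>. pmf (\<alpha> hist h s) a) \<in> borel_measurable \<A>)"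

text \<open>
  \<open>history H s0 Ms \<alpha> k\<close> is the law of the trajectories of episodes \<open>1, \<dots>, k\<close>, oldest first,
  when the MDP of episode \<open>j\<close> is \<open>Ms j\<close>.
\<close>

primrec history ::
    "nat \<Rightarrow> 's \<Rightarrow> (nat \<Rightarrow> ('s, 'a) mdp) \<Rightarrow> ('s, 'a) det_algorithm \<Rightarrow> nat
       \<Rightarrow> ('s, 'a) trajectory list pmf" where
  "history H s0 Ms \<alpha> 0 = return_pmf []"
| "history H s0 Ms \<alpha> (Suc k) = do {
     hist \<leftarrow> history H s0 Ms \<alpha> k;
     \<tau> \<leftarrow> episode H s0 (Ms (Suc k)) (\<alpha> hist);
     return_pmf (hist @ [\<tau>])
   }"

text \<open>
  The expectation of the value of the policy deployed in episode \<open>k\<close>, over the internal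
  randomness of the algorithm and over the trajectories of episodes \<open>1, \<dots>, k - 1\<close>.
\<close>

definition learner_value ::
    "nat \<Rightarrow> 's \<Rightarrow> (nat \<Rightarrow> ('s, 'a) mdp) \<Rightarrow> ('s, 'a) det_algorithm measure \<Rightarrow> nat \<Rightarrow> real" where
  "learner_value H s0 Ms \<A> k =
     (\<integral>\<alpha>. measure_pmf.expectation (history H s0 Ms \<alpha> (k - 1))
              (\<lambda>hist. policy_value H s0 (Ms k) (\<alpha> hist)) \<partial>\<A>)"

end

theory Submission
  imports Defs
begin

text \<open>
  The adversary fixes a secret action sequence \<open>xs\<close> of length \<open>H\<close>.  At every step one of the two
  states means that all actions so far agree with \<open>xs\<close>; which one it is, is drawn afresh in every
  episode and at every step.  The observed states are then independent fair coins, so the learner sees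
  only its actions and the final reward, whose mean is \<open>1/2 + \<epsilon>\<close> if the action sequence is \<open>xs\<close> and
  \<open>1/2\<close> otherwise: a bandit with \<open>2 ^ H\<close> arms.  On average over \<open>xs\<close>, a change of measure to the
  problem without a secret shows that the learner plays \<open>xs\<close> in at most \<open>3/4\<close> of the episodes
  when \<open>\<epsilon>\<close> is a small multiple of \<open>min 1 (sqrt (2 ^ H / K))\<close>, while the policy replaying \<open>xs\<close>
  ignores the states.
\<close>

section \<open>Bandits with one hidden good arm\<close>

lemma expectation_bind_finite:
  fixes h :: "'b \<Rightarrow> real"
  assumes "finite (set_pmf p)" "\<And>x. x \<in> set_pmf p \<Longrightarrow> finite (set_pmf (f x))"
  shows "measure_pmf.expectation (p \<bind> f) h =
    measure_pmf.expectation p (\<lambda>x. measure_pmf.expectation (f x) h)"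
  by (subst pmf_expectation_bind[of "set_pmf p"], use assms in auto)
     (subst integral_measure_pmf[of "set_pmf p"], use assms in auto)

lemma expectation_mono_finite:
  fixes f g :: "'a \<Rightarrow> real"
  assumes "finite (set_pmf p)" "\<And>x. x \<in> set_pmf p \<Longrightarrow> f x \<le> g x"
  shows "measure_pmf.expectation p f \<le> measure_pmf.expectation p g"
  by (intro integral_mono_AE integrable_measure_pmf_finite assms) (auto simp: AE_measure_pmf_iff assms)

lemma expectation_cong_pmf:
  fixes f g :: "'a \<Rightarrow> real"
  assumes "\<And>x. x \<in> set_pmf p \<Longrightarrow> f x = g x"
  shows "measure_pmf.expectation p f = measure_pmf.expectation p g"
  by (intro integral_cong_AE) (auto simp: AE_measure_pmf_iff assms)

text \<open>Second-order Taylor bound, used on likelihood ratios within 1/2 of 1: the linear term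
  will have mean 0, so only the quadratic one survives. The factor 2 suits both signs of
  \<open>x\<close>.\<close>

lemma ln_one_plus_ge:
  fixes x :: real
  assumes "\<bar>x\<bar> \<le> 1/2"
  shows "x - 2 * x\<^sup>2 \<le> ln (1 + x)"
proof (cases "x \<ge> 0")
  case True
  have "x - x\<^sup>2 \<le> ln (1 + x)"
    by (rule ln_one_plus_pos_lower_bound) (use assms True in auto)
  then show ?thesis using zero_le_power2[of x] by linarith
next
  case False
  then show ?thesis using ln_one_minus_pos_lower_bound[of "-x"] assms by auto
qed

text \<open>
  Replaces Pinsker's inequality: for a density \<open>z\<close>, the right-hand side has mean
  \<open>E p + 1/3 + 2 KL\<close>, which is linear in the divergence and can be averaged over the arms.
\<close>
lemma change_of_measure_pointwise:
  fixes z p :: real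
  assumes "z > 0" "0 \<le> p" "p \<le> 1"
  shows "z * p \<le> p + (z - 1) + 1/3 + 2 * (z - 1 - ln z)"
proof -
  have "z * p - p \<le> max 0 (z - 1)"
  proof (cases "z \<ge> 1")
    case True
    then have "(z - 1) * p \<le> (z - 1) * 1" using assms by (intro mult_left_mono) auto
    then show ?thesis by (simp add: algebra_simps)
  next
    case False
    then have "(1 - z) * p \<ge> 0" using assms by simp
    then show ?thesis by (simp add: algebra_simps)
  qed
  \<comment> \<open>Because \<open>max 0 (z - 1) = (z - 1) + max 0 (1 - z)\<close>, this bound and
    the next one suffice.\<close>
  moreover have "0 \<le> 1/3 + 2 * (z - 1 - ln z)"
    using ln_le_minus_one[OF assms(1)] by simp
  moreover have "1 - z \<le> 1/3 + 2 * (z - 1 - ln z)"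
  proof -
    \<comment> \<open>\<open>z + 2 * (z - 1 - ln z)\<close> is smallest at \<open>z = 2/3\<close>;
      the tangent of \<open>ln\<close> there, together with \<open>ln (2/3) \<le> - 1/3\<close>,
      gives the constant 1/3.\<close>
    have "ln (3/2 * z) \<le> 3/2 * z - 1" using assms by (intro ln_le_minus_one) auto
    moreover have "ln (3/2 * z) = ln (3/2) + ln z" using assms by (intro ln_mult_pos) auto
    moreover have "ln (2/3::real) \<le> 2/3 - 1" by (intro ln_le_minus_one) auto
    moreover have "ln (2/3::real) = - ln (3/2)" by (simp add: ln_div)
    ultimately show ?thesis by (simp add: algebra_simps)
  qed
  ultimately show ?thesis by linarith
qed

section \<open>Adaptive observations with one perturbed arm: likelihood ratios and
  divergence\<close>

primrec feedback :: "('o list \<Rightarrow> 'o pmf) \<Rightarrow> nat \<Rightarrow> 'o list pmf" where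
  "feedback Q 0 = return_pmf []"
| "feedback Q (Suc k) = do { hist \<leftarrow> feedback Q k; x \<leftarrow> Q hist; return_pmf (hist @ [x]) }"

lemma finite_set_feedback:
  assumes "\<And>hist. finite (set_pmf (Q hist))"
  shows "finite (set_pmf (feedback Q k))"
  by (induction k) (auto simp: assms)

lemma expectation_feedback_Suc:
  fixes f :: "'o list \<Rightarrow> real"
  assumes "\<And>hist. finite (set_pmf (Q hist))"
  shows "measure_pmf.expectation (feedback Q (Suc k)) f =
    measure_pmf.expectation (feedback Q k)
      (\<lambda>hist. measure_pmf.expectation (Q hist) (\<lambda>x. f (hist @ [x])))"
  using finite_set_feedback[of Q k, OF assms] assms
  by (simp add: expectation_bind_finite)

text \<open>\<open>Q0\<close> is the problem without a good arm; \<open>Q i\<close> raises the mean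
  reward on arm \<open>i\<close> from 1/2 to 1/2 + \<epsilon>. The arm is read off the observation
  through \<open>hit\<close>, so an observation may be a whole trajectory of a randomized policy,
  and \<open>pmf_Q\<close> prescribes only the likelihood ratio.\<close>

locale hidden_arm =
  fixes I :: "'i set" and hit :: "'i \<Rightarrow> 'o \<Rightarrow> bool" and rew :: "'o \<Rightarrow> real" and \<epsilon> :: real
    and Q0 :: "'o list \<Rightarrow> 'o pmf" and Q :: "'i \<Rightarrow> 'o list \<Rightarrow> 'o pmf"
  assumes finite_I: "finite I"
    and eps: "0 < \<epsilon>" "\<epsilon> \<le> 1/4"
    and finite_Q0: "finite (set_pmf (Q0 hist))"
    and rew_01: "x \<in> set_pmf (Q0 hist) \<Longrightarrow> rew x \<in> {0, 1}"
    and one_hit: "x \<in> set_pmf (Q0 hist) \<Longrightarrow> (\<Sum>i\<in>I. of_bool (hit i x)) = (1::real)"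
    and pmf_Q: "i \<in> I \<Longrightarrow>
      pmf (Q i hist) x = pmf (Q0 hist) x * (1 + of_bool (hit i x) * (2 * \<epsilon> * (2 * rew x - 1)))"
begin

abbreviation E :: "'a pmf \<Rightarrow> ('a \<Rightarrow> real) \<Rightarrow> real" where
  "E \<equiv> measure_pmf.expectation"

text \<open>Density of \<open>Q i hist\<close> against \<open>Q0 hist\<close>. It does not depend on
  \<open>hist\<close>, so the density of a whole history is the product \<open>Z i\<close>.\<close>

definition w :: "'i \<Rightarrow> 'o \<Rightarrow> real" where
  "w i x = 1 + of_bool (hit i x) * (2 * \<epsilon> * (2 * rew x - 1))"

definition Z :: "'i \<Rightarrow> 'o list \<Rightarrow> real" where
  "Z i hist = prod_list (map (w i) hist)"

definition hitprob :: "'i \<Rightarrow> 'o list \<Rightarrow> real" where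
  "hitprob i hist = E (Q0 hist) (\<lambda>x. of_bool (hit i x))"

lemma set_Q_subset: "i \<in> I \<Longrightarrow> set_pmf (Q i hist) \<subseteq> set_pmf (Q0 hist)"
  by (auto simp: set_pmf_iff pmf_Q)

lemma finite_Q: "i \<in> I \<Longrightarrow> finite (set_pmf (Q i hist))"
  using set_Q_subset finite_Q0 finite_subset by metis

lemma int_Q0: "integrable (measure_pmf (Q0 hist)) (f :: _ \<Rightarrow> real)"
  by (rule integrable_measure_pmf_finite[OF finite_Q0])

lemma int_feedback: "integrable (measure_pmf (feedback Q0 k)) (f :: _ \<Rightarrow> real)"
  by (rule integrable_measure_pmf_finite[OF finite_set_feedback[OF finite_Q0]])

lemma expectation_Q:
  assumes "i \<in> I"
  shows "E (Q i hist) f = E (Q0 hist) (\<lambda>x. w i x * f x)"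
proof -
  have "E (Q i hist) f = (\<Sum>x\<in>set_pmf (Q0 hist). pmf (Q i hist) x *\<^sub>R f x)"
    by (rule integral_measure_pmf[OF finite_Q0]) (use set_Q_subset assms in auto)
  also have "\<dots> = (\<Sum>x\<in>set_pmf (Q0 hist). pmf (Q0 hist) x *\<^sub>R (w i x * f x))"
    using assms by (intro sum.cong) (auto simp: pmf_Q w_def algebra_simps)
  also have "\<dots> = E (Q0 hist) (\<lambda>x. w i x * f x)"
    by (rule integral_measure_pmf[OF finite_Q0, symmetric]) auto
  finally show ?thesis .
qed

lemma w_bounds: "x \<in> set_pmf (Q0 hist) \<Longrightarrow> \<bar>w i x - 1\<bar> \<le> 1/2"
  using rew_01[of x hist] eps by (auto simp: w_def abs_mult)

lemma w_pos: "x \<in> set_pmf (Q0 hist) \<Longrightarrow> w i x > 0"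
  using w_bounds[of x hist i] by (auto simp: abs_if split: if_splits)

lemma sum_hitprob: "(\<Sum>i\<in>I. hitprob i hist) = 1"
proof -
  have "(\<Sum>i\<in>I. hitprob i hist) = E (Q0 hist) (\<lambda>x. \<Sum>i\<in>I. of_bool (hit i x))"
    unfolding hitprob_def by (subst Bochner_Integration.integral_sum) (auto simp: int_Q0)
  also have "\<dots> = E (Q0 hist) (\<lambda>_. 1)"
    by (rule expectation_cong_pmf) (simp add: one_hit)
  finally show ?thesis by simp
qed

lemma hitprob_nonneg: "0 \<le> hitprob i hist"
  unfolding hitprob_def by (intro integral_nonneg_AE) auto

lemma hitprob_le_1: "hitprob i hist \<le> 1"
  unfolding hitprob_def
  using expectation_mono_finite[OF finite_Q0, of hist "\<lambda>x. of_bool (hit i x)" "\<lambda>_. 1"] by simp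

text \<open>The reward of a hit is a fair coin under \<open>Q0\<close>, because the density \<open>w i\<close> has mass 1.\<close>
lemma fair_on_hit:
  assumes "i \<in> I"
  shows "E (Q0 hist) (\<lambda>x. of_bool (hit i x) * (2 * rew x - 1)) = 0"
proof -
  have "1 = E (Q i hist) (\<lambda>_. 1)" by simp
  also have "\<dots> = E (Q0 hist) (\<lambda>x. 1 + 2 * \<epsilon> * (of_bool (hit i x) * (2 * rew x - 1)))"
    unfolding expectation_Q[OF assms] w_def by (simp add: algebra_simps)
  also have "\<dots> = 1 + 2 * \<epsilon> * E (Q0 hist) (\<lambda>x. of_bool (hit i x) * (2 * rew x - 1))"
    by (subst Bochner_Integration.integral_add) (auto simp: int_Q0)
  finally show ?thesis using eps by simp
qed

lemma expectation_hit_rew: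
  assumes "i \<in> I"
  shows "E (Q0 hist) (\<lambda>x. of_bool (hit i x) * rew x) = hitprob i hist / 2"
proof -
  have "E (Q0 hist) (\<lambda>x. of_bool (hit i x) * (2 * rew x - 1)) =
      E (Q0 hist) (\<lambda>x. 2 * (of_bool (hit i x) * rew x) - of_bool (hit i x))"
    by (simp add: algebra_simps)
  also have "\<dots> = 2 * E (Q0 hist) (\<lambda>x. of_bool (hit i x) * rew x) - hitprob i hist"
    unfolding hitprob_def by (subst Bochner_Integration.integral_diff) (auto simp: int_Q0)
  finally show ?thesis using fair_on_hit[OF assms] by simp
qed

text \<open>Splitting by the unique arm that is hit, arm \<open>i\<close> contributes half of its
  probability, and these probabilities add up to 1.\<close>

lemma expectation_rew_Q0: "E (Q0 hist) rew = 1/2"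
proof -
  have "E (Q0 hist) rew = E (Q0 hist) (\<lambda>x. \<Sum>i\<in>I. of_bool (hit i x) * rew x)"
    by (rule expectation_cong_pmf) (simp add: one_hit flip: sum_distrib_right)
  also have "\<dots> = (\<Sum>i\<in>I. hitprob i hist / 2)"
    by (subst Bochner_Integration.integral_sum) (auto simp: int_Q0 expectation_hit_rew)
  finally show ?thesis using sum_hitprob[of hist] by (simp flip: sum_divide_distrib)
qed

lemma expectation_rew_Q:
  assumes "i \<in> I"
  shows "E (Q i hist) rew = 1/2 + \<epsilon> * hitprob i hist"
proof -
  \<comment> \<open>For \<open>rew x\<close> in \<open>{0, 1}\<close> the product
    \<open>(2 * rew x - 1) * rew x\<close> is \<open>rew x\<close>.\<close>
  have "E (Q i hist) rew = E (Q0 hist) (\<lambda>x. rew x + 2 * \<epsilon> * (of_bool (hit i x) * rew x))"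
    unfolding expectation_Q[OF assms] w_def
    by (rule expectation_cong_pmf) (use rew_01 in fastforce)
  also have "\<dots> = E (Q0 hist) rew + 2 * \<epsilon> * E (Q0 hist) (\<lambda>x. of_bool (hit i x) * rew x)"
    by (subst Bochner_Integration.integral_add) (auto simp: int_Q0)
  finally show ?thesis by (simp add: expectation_rew_Q0 expectation_hit_rew[OF assms])
qed

text \<open>The left side is the one-round divergence of \<open>Q i hist\<close> from
  \<open>Q0 hist\<close>. In \<open>ln_one_plus_ge\<close> the linear term has mean 0 by
  \<open>fair_on_hit\<close>, and the quadratic term is \<open>2 * (2 * \<epsilon>)\<^sup>2\<close>,
  present only on a hit.\<close>

lemma divergence_step:
  assumes "i \<in> I"
  shows "E (Q0 hist) (\<lambda>x. - ln (w i x)) \<le> 8 * \<epsilon>\<^sup>2 * hitprob i hist"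
proof -
  have "E (Q0 hist) (\<lambda>x. - ln (w i x)) \<le>
      E (Q0 hist) (\<lambda>x. 8 * \<epsilon>\<^sup>2 * of_bool (hit i x) - 2 * \<epsilon> * (of_bool (hit i x) * (2 * rew x - 1)))"
  proof (rule expectation_mono_finite[OF finite_Q0])
    fix x assume x: "x \<in> set_pmf (Q0 hist)"
    show "- ln (w i x) \<le> 8 * \<epsilon>\<^sup>2 * of_bool (hit i x) - 2 * \<epsilon> * (of_bool (hit i x) * (2 * rew x - 1))"
      using ln_one_plus_ge[OF w_bounds[OF x, of i]] rew_01[OF x]
      by (auto simp: w_def power2_eq_square algebra_simps)
  qed
  also have "\<dots> = 8 * \<epsilon>\<^sup>2 * hitprob i hist"
    unfolding hitprob_def
    by (subst Bochner_Integration.integral_diff) (simp_all add: int_Q0 fair_on_hit[OF assms])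
  finally show ?thesis .
qed

lemma Z_append [simp]: "Z i (hist @ [x]) = Z i hist * w i x"
  by (simp add: Z_def)

lemma Z_pos: "hist \<in> set_pmf (feedback Q0 k) \<Longrightarrow> Z i hist > 0"
proof (induction k arbitrary: hist)
  case (Suc k)
  then obtain h x where "h \<in> set_pmf (feedback Q0 k)" "x \<in> set_pmf (Q0 h)" "hist = h @ [x]"
    by auto
  with Suc.IH[of h] w_pos[of x h i] show ?case by (auto intro!: mult_pos_pos)
qed (simp add: Z_def)

lemma expectation_feedback_Q:
  assumes "i \<in> I"
  shows "E (feedback (Q i) k) f = E (feedback Q0 k) (\<lambda>hist. Z i hist * f hist)"
proof (induction k arbitrary: f)
  case (Suc k)
  show ?case
    unfolding expectation_feedback_Suc[OF finite_Q[OF assms]] expectation_feedback_Suc[OF finite_Q0]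
      Suc expectation_Q[OF assms]
    by (simp add: mult.assoc)
qed (simp add: Z_def)

definition hits :: "'i \<Rightarrow> nat \<Rightarrow> real" where
  "hits i k = (\<Sum>j<k. E (feedback Q0 j) (hitprob i))"

text \<open>The arms share one play per round, so an average arm is played only
  \<open>k / card I\<close> times; this is where many arms help the adversary.\<close>

lemma sum_hits: "(\<Sum>i\<in>I. hits i k) = real k"
proof -
  have "(\<Sum>i\<in>I. E (feedback Q0 j) (hitprob i)) = 1" for j
    by (subst Bochner_Integration.integral_sum[symmetric]) (simp_all add: int_feedback sum_hitprob)
  then show ?thesis unfolding hits_def by (subst sum.swap) simp
qed

text \<open>Chain rule: \<open>- ln (Z i hist)\<close> adds up over the rounds, and each expected
  play of arm \<open>i\<close> costs at most \<open>8 * \<epsilon>\<^sup>2\<close>.\<close>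

lemma divergence_feedback:
  assumes "i \<in> I"
  shows "E (feedback Q0 k) (\<lambda>hist. - ln (Z i hist)) \<le> 8 * \<epsilon>\<^sup>2 * hits i k"
proof (induction k)
  case (Suc k)
  have "E (feedback Q0 (Suc k)) (\<lambda>hist. - ln (Z i hist)) =
      E (feedback Q0 k) (\<lambda>hist. E (Q0 hist) (\<lambda>x. - ln (Z i hist) + - ln (w i x)))"
    unfolding expectation_feedback_Suc[OF finite_Q0]
  proof (intro expectation_cong_pmf)
    fix hist x assume "hist \<in> set_pmf (feedback Q0 k)" "x \<in> set_pmf (Q0 hist)"
    then show "- ln (Z i (hist @ [x])) = - ln (Z i hist) + - ln (w i x)"
      using Z_pos[of hist k i] w_pos[of x hist i] by (simp add: ln_mult_pos)
  qed
  also have "\<dots> = E (feedback Q0 k) (\<lambda>hist. - ln (Z i hist) + E (Q0 hist) (\<lambda>x. - ln (w i x)))"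
    by (subst Bochner_Integration.integral_add) (auto simp: int_Q0)
  also have "\<dots> = E (feedback Q0 k) (\<lambda>hist. - ln (Z i hist)) +
      E (feedback Q0 k) (\<lambda>hist. E (Q0 hist) (\<lambda>x. - ln (w i x)))"
    by (rule Bochner_Integration.integral_add) (rule int_feedback)+
  also have "E (feedback Q0 k) (\<lambda>hist. E (Q0 hist) (\<lambda>x. - ln (w i x))) \<le>
      E (feedback Q0 k) (\<lambda>hist. 8 * \<epsilon>\<^sup>2 * hitprob i hist)"
    by (intro expectation_mono_finite finite_set_feedback finite_Q0 divergence_step assms)
  finally show ?case using Suc by (simp add: hits_def algebra_simps)
qed (simp add: Z_def hits_def)

lemma hitprob_change_of_measure:
  assumes "i \<in> I"
  shows "E (feedback (Q i) k) (hitprob i) \<le>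
    E (feedback Q0 k) (hitprob i) + 1/3 + 16 * \<epsilon>\<^sup>2 * hits i k"
proof -
  have Z1: "E (feedback Q0 k) (Z i) = 1"
    using expectation_feedback_Q[OF assms, of k "\<lambda>_. 1"] by simp
  have "E (feedback (Q i) k) (hitprob i) = E (feedback Q0 k) (\<lambda>hist. Z i hist * hitprob i hist)"
    by (rule expectation_feedback_Q[OF assms])
  \<comment> \<open>With \<open>z = Z i hist\<close>, the terms \<open>3 * z - 8/3\<close> collect
    \<open>(z - 1) + 1/3 + 2 * (z - 1)\<close>; since \<open>Z i\<close> has mean 1, they leave
    exactly 1/3.\<close>
  also have "\<dots> \<le> E (feedback Q0 k)
      (\<lambda>hist. hitprob i hist + 3 * Z i hist + 2 * (- ln (Z i hist)) - 8/3)"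
  proof (rule expectation_mono_finite)
    fix hist assume "hist \<in> set_pmf (feedback Q0 k)"
    from change_of_measure_pointwise[OF Z_pos[OF this, of i] hitprob_nonneg hitprob_le_1, of i hist]
    show "Z i hist * hitprob i hist \<le> hitprob i hist + 3 * Z i hist + 2 * (- ln (Z i hist)) - 8/3"
      by simp
  qed (rule finite_set_feedback finite_Q0)+
  also have "\<dots> = E (feedback Q0 k) (hitprob i) + 3 * E (feedback Q0 k) (Z i)
      + 2 * E (feedback Q0 k) (\<lambda>hist. - ln (Z i hist)) - 8/3"
    by (simp add: int_feedback)
  finally show ?thesis using Z1 divergence_feedback[OF assms, of k] by simp
qed

text \<open>After summing over the arms, the hit probabilities of one round add up to 1 and the
  expected plays to \<open>k\<close>; inside the bracket only the slack 1/3 is paid once per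
  arm.\<close>

lemma average_reward_le:
  "(\<Sum>i\<in>I. E (feedback (Q i) (Suc k)) (\<lambda>hist. rew (last hist))) \<le>
     card I / 2 + \<epsilon> * (1 + card I / 3 + 16 * \<epsilon>\<^sup>2 * k)"
proof -
  have "E (feedback (Q i) (Suc k)) (\<lambda>hist. rew (last hist)) =
      1/2 + \<epsilon> * E (feedback (Q i) k) (hitprob i)" if i: "i \<in> I" for i
    unfolding expectation_feedback_Suc[OF finite_Q[OF i]]
    by (simp add: expectation_rew_Q[OF i] integrable_measure_pmf_finite finite_set_feedback finite_Q[OF i])
  then have "(\<Sum>i\<in>I. E (feedback (Q i) (Suc k)) (\<lambda>hist. rew (last hist))) =
      card I / 2 + \<epsilon> * (\<Sum>i\<in>I. E (feedback (Q i) k) (hitprob i))"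
    by (simp add: sum.distrib sum_distrib_left)
  also have "(\<Sum>i\<in>I. E (feedback (Q i) k) (hitprob i)) \<le>
      (\<Sum>i\<in>I. E (feedback Q0 k) (hitprob i) + 1/3 + 16 * \<epsilon>\<^sup>2 * hits i k)"
    by (intro sum_mono hitprob_change_of_measure)
  also have "\<dots> = (\<Sum>i\<in>I. E (feedback Q0 k) (hitprob i)) + card I / 3 + 16 * \<epsilon>\<^sup>2 * k"
    by (simp add: sum.distrib sum_hits flip: sum_distrib_left)
  also have "(\<Sum>i\<in>I. E (feedback Q0 k) (hitprob i)) = 1"
    by (subst Bochner_Integration.integral_sum[symmetric]) (simp_all add: int_feedback sum_hitprob)
  finally show ?thesis using eps by simp
qed

end

section \<open>Combination locks with random state labels\<close>

abbreviation coin :: "nat pmf" where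
  "coin \<equiv> pmf_of_set {0, 1}"

definition gain :: "('s, 'a) trajectory \<Rightarrow> real" where
  "gain \<tau> = (\<Sum>(s, a, r)\<leftarrow>\<tau>. r)"

definition acts :: "('s, 'a) trajectory \<Rightarrow> 'a list" where
  "acts \<tau> = map (\<lambda>(s, a, r). a) \<tau>"

lemma gain_simps [simp]: "gain [] = 0" "gain ((s, a, r) # \<tau>) = r + gain \<tau>"
  by (simp_all add: gain_def)

lemma acts_simps [simp]: "acts [] = []" "acts ((s, a, r) # \<tau>) = a # acts \<tau>"
  by (simp_all add: acts_def)

definition lock_reward :: "nat \<Rightarrow> real \<Rightarrow> nat \<Rightarrow> bool \<Rightarrow> real pmf" where
  "lock_reward H \<epsilon> h g =
     (if h = H then map_pmf of_bool (bernoulli_pmf (1/2 + (if g then \<epsilon> else 0))) else return_pmf 0)"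

text \<open>
  The label \<open>b h\<close> names the state at step \<open>h\<close> that is reached exactly when all
  earlier actions agree with the secret \<open>xs\<close>.
\<close>
definition lock :: "nat \<Rightarrow> real \<Rightarrow> nat list \<Rightarrow> (nat \<Rightarrow> nat) \<Rightarrow> (nat, nat) mdp" where
  "lock H \<epsilon> xs b =
     \<lparr> trans = \<lambda>h s a. return_pmf (if s = b h \<and> a = xs ! (h - 1) then b (Suc h) else 1 - b (Suc h)),
       reward = \<lambda>h s a. lock_reward H \<epsilon> h (s = b h \<and> a = xs ! (h - 1)) \<rparr>"

text \<open>Labels outside \<open>{h<..H}\<close> take the default 0; for \<open>h = 1\<close> this
  makes the fixed initial state 0 the good one at step 1.\<close>

definition labels :: "nat \<Rightarrow> nat \<Rightarrow> (nat \<Rightarrow> nat) pmf" where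
  "labels H h = Pi_pmf {h<..H} 0 (\<lambda>_. coin)"

text \<open>
  \<open>masked\<close> is the law of a trajectory averaged over random labels; the flag \<open>g\<close> records
  whether all previous actions were correct.  With \<open>\<epsilon> = 0\<close>, neither \<open>g\<close> nor \<open>xs\<close> matters.
\<close>
primrec masked :: "nat \<Rightarrow> real \<Rightarrow> nat list \<Rightarrow> (nat, nat) policy \<Rightarrow> nat \<Rightarrow> bool \<Rightarrow> nat \<Rightarrow> nat
    \<Rightarrow> (nat, nat) trajectory pmf" where
  "masked H \<epsilon> xs \<mu> 0 g h s = return_pmf []"
| "masked H \<epsilon> xs \<mu> (Suc n) g h s = do {
     a \<leftarrow> \<mu> h s;
     r \<leftarrow> lock_reward H \<epsilon> h (g \<and> a = xs ! (h - 1));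
     s' \<leftarrow> coin;
     \<tau> \<leftarrow> masked H \<epsilon> xs \<mu> n (g \<and> a = xs ! (h - 1)) (Suc h) s';
     return_pmf ((s, a, r) # \<tau>)
   }"

lemma rollout_cong:
  assumes "\<And>i. i \<ge> h \<Longrightarrow> trans M i = trans M' i" "\<And>i. i \<ge> h \<Longrightarrow> reward M i = reward M' i"
  shows "rollout M \<mu> n h s = rollout M' \<mu> n h s"
  using assms by (induction n arbitrary: h s) (auto intro!: bind_pmf_cong)

text \<open>This symmetry hides mistakes: a uniformly labelled good state and its complement have
  the same law.\<close>

lemma coin_reflect: "map_pmf (\<lambda>s. 1 - s) coin = coin"
  by (subst map_pmf_of_set_inj) (auto simp: inj_on_def insert_commute)

lemma set_labels: "b \<in> set_pmf (labels H h) \<Longrightarrow> b i \<in> {0, 1}"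
  by (cases "i \<in> {h<..H}") (auto simp: labels_def set_Pi_pmf PiE_dflt_def)

lemma labels_outside: "b \<in> set_pmf (labels H h) \<Longrightarrow> i \<le> h \<Longrightarrow> b i = 0"
  by (auto simp: labels_def set_Pi_pmf PiE_dflt_def)

lemma finite_set_labels: "finite (set_pmf (labels H h))"
  by (auto simp: labels_def set_Pi_pmf)

text \<open>The update at \<open>h\<close> chooses the label so that the current state
  \<open>s\<close> is good exactly when \<open>g\<close> holds. Whether or not the next action is
  correct, the fresh label at \<open>Suc h\<close> makes the next state a fair coin; given that
  state, the label is determined by the new flag, which restores the form needed for the
  induction.\<close>

lemma average_over_labels:
  assumes "h + n = Suc H" "s \<in> {0, 1}"
  shows "labels H h \<bind> (\<lambda>b. rollout (lock H \<epsilon> xs (b(h := if g then s else 1 - s))) \<mu> n h s)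
    = masked H \<epsilon> xs \<mu> n g h s"
  using assms
proof (induction n arbitrary: g h s)
  case (Suc n)
  \<comment> \<open>The label at step \<open>h\<close> is consulted only at this step, so the rest
    of the rollout can use \<open>b\<close> itself.\<close>
  have step: "rollout (lock H \<epsilon> xs (b(h := if g then s else 1 - s))) \<mu> (Suc n) h s = do {
      a \<leftarrow> \<mu> h s;
      r \<leftarrow> lock_reward H \<epsilon> h (g \<and> a = xs ! (h - 1));
      \<tau> \<leftarrow> rollout (lock H \<epsilon> xs b) \<mu> n (Suc h)
             (if g \<and> a = xs ! (h - 1) then b (Suc h) else 1 - b (Suc h));
      return_pmf ((s, a, r) # \<tau>) }" for b
  proof -
    have "rollout (lock H \<epsilon> xs (b(h := v))) \<mu> n (Suc h) s' = rollout (lock H \<epsilon> xs b) \<mu> n (Suc h) s'"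
      for v s' by (rule rollout_cong) (auto simp: lock_def cong: if_cong)
    moreover have "(s = (if g then s else 1 - s)) = g" using Suc.prems(2) by auto
    ultimately show ?thesis
      by (simp add: lock_def bind_return_pmf cong: if_cong)
  qed
  have rest: "labels H h \<bind> (\<lambda>b. rollout (lock H \<epsilon> xs b) \<mu> n (Suc h)
        (if g' then b (Suc h) else 1 - b (Suc h)))
      = coin \<bind> (\<lambda>s'. masked H \<epsilon> xs \<mu> n g' (Suc h) s')" for g'
  \<comment> \<open>For \<open>n = 0\<close> both sides are the empty trajectory; otherwise
    \<open>Suc h\<close> carries a random label.\<close>
  proof (cases "n = 0")
    case False
    then have "Suc h \<le> H" using Suc.prems by simp
    then have "{h<..H} = insert (Suc h) {Suc h<..H}" by auto
    then have "labels H h = do {y \<leftarrow> coin; b \<leftarrow> labels H (Suc h); return_pmf (b(Suc h := y))}"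
      unfolding labels_def by (simp add: Pi_pmf_insert')
    \<comment> \<open>The draw of the label is reparametrised by the next state \<open>s'\<close>;
      for a lost flag this is \<open>coin_reflect\<close>.\<close>
    also have "\<dots> = do {s' \<leftarrow> coin; b \<leftarrow> labels H (Suc h);
        return_pmf (b(Suc h := if g' then s' else 1 - s'))}"
      by (cases g') (simp, subst coin_reflect[symmetric], simp add: bind_map_pmf)
    finally have *: "labels H h = \<dots>" .
    show ?thesis
      unfolding * bind_assoc_pmf bind_return_pmf
    proof (rule bind_pmf_cong[OF refl])
      fix s' assume "s' \<in> set_pmf coin"
      then have s': "s' \<in> {0, 1}" by simp
      then have eq: "(if g' then (if g' then s' else 1 - s') else 1 - (if g' then s' else 1 - s')) = s'"
        by auto
      show "labels H (Suc h) \<bind> (\<lambda>b. rollout (lock H \<epsilon> xs (b(Suc h := if g' then s' else 1 - s')))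
          \<mu> n (Suc h) (if g' then (b(Suc h := if g' then s' else 1 - s')) (Suc h)
             else 1 - (b(Suc h := if g' then s' else 1 - s')) (Suc h)))
        = masked H \<epsilon> xs \<mu> n g' (Suc h) s'"
        unfolding fun_upd_same eq by (rule Suc.IH) (use Suc.prems(1) s' in simp_all)
    qed
  qed simp
  \<comment> \<open>The laws of the action and of the reward do not involve \<open>b\<close>, so the
    draw of the labels commutes past both.\<close>
  have "labels H h \<bind> (\<lambda>b. rollout (lock H \<epsilon> xs (b(h := if g then s else 1 - s))) \<mu> (Suc n) h s) = do {
      a \<leftarrow> \<mu> h s;
      r \<leftarrow> lock_reward H \<epsilon> h (g \<and> a = xs ! (h - 1));
      b \<leftarrow> labels H h;
      \<tau> \<leftarrow> rollout (lock H \<epsilon> xs b) \<mu> n (Suc h)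
             (if g \<and> a = xs ! (h - 1) then b (Suc h) else 1 - b (Suc h));
      return_pmf ((s, a, r) # \<tau>) }"
    unfolding step
    by (subst bind_commute_pmf, rule bind_pmf_cong[OF refl], subst bind_commute_pmf) (rule refl)
  also have "\<dots> = masked H \<epsilon> xs \<mu> (Suc n) g h s"
    unfolding masked.simps
    by (intro bind_pmf_cong[OF refl]) (simp only: rest flip: bind_assoc_pmf)
  finally show ?case .
qed simp

lemma average_episode:
  "labels H 1 \<bind> (\<lambda>b. episode H 0 (lock H \<epsilon> xs b) \<mu>) = masked H \<epsilon> xs \<mu> H True 1 0"
proof -
  have "labels H 1 \<bind> (\<lambda>b. episode H 0 (lock H \<epsilon> xs b) \<mu>) =
      labels H 1 \<bind> (\<lambda>b. rollout (lock H \<epsilon> xs (b(1 := if True then 0 else 1 - 0))) \<mu> H 1 0)"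
  proof (rule bind_pmf_cong[OF refl])
    fix b assume "b \<in> set_pmf (labels H 1)"
    then have "b(1 := if True then 0 else 1 - 0) = b" using labels_outside[of b H 1 1] by auto
    then show "episode H 0 (lock H \<epsilon> xs b) \<mu> =
        rollout (lock H \<epsilon> xs (b(1 := if True then 0 else 1 - 0))) \<mu> H 1 0"
      unfolding episode_def by simp
  qed
  also have "\<dots> = masked H \<epsilon> xs \<mu> H True 1 0"
    by (rule average_over_labels) auto
  finally show ?thesis .
qed

section \<open>The density of the masked law with a secret against the one without\<close>

lemma nn_integral_biased_coin:
  fixes f :: "bool \<Rightarrow> ennreal"
  assumes "0 \<le> \<epsilon>" "\<epsilon> \<le> 1/2"
  shows "(\<integral>\<^sup>+x. f x \<partial>bernoulli_pmf (1/2 + \<epsilon>)) =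
    (\<integral>\<^sup>+x. f x * ennreal (1 + 2 * \<epsilon> * (2 * of_bool x - 1)) \<partial>bernoulli_pmf (1/2))"
proof -
  have "ennreal ((1 + 2 * \<epsilon>) * (1/2)) = ennreal (1 + 2 * \<epsilon>) * ennreal (1/2)"
    "ennreal ((1 - 2 * \<epsilon>) * (1/2)) = ennreal (1 - 2 * \<epsilon>) * ennreal (1/2)"
    using assms by (intro ennreal_mult; simp)+
  moreover have "1/2 + \<epsilon> = (1 + 2 * \<epsilon>) * (1/2)" "1 - (1/2 + \<epsilon>) = (1 - 2 * \<epsilon>) * (1/2)"
    by (simp_all add: field_simps)
  ultimately have "ennreal (1/2 + \<epsilon>) = ennreal (1 + 2 * \<epsilon>) * ennreal (1/2)"
    "ennreal (1 - (1/2 + \<epsilon>)) = ennreal (1 - 2 * \<epsilon>) * ennreal (1/2)"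
    by metis+
  then show ?thesis
    using assms by (simp add: mult.assoc)
qed

text \<open>States and actions have the same law on both sides; only the last coin is tilted, and
  \<open>gain\<close> equals its outcome because earlier rewards are 0. Arbitrary nonnegative test
  functions let the induction prepend the current triple without integrability conditions.\<close>

lemma nn_integral_masked:
  assumes "h + n = Suc H" "n > 0" "h > 0" "length xs = H" "0 \<le> \<epsilon>" "\<epsilon> \<le> 1/2"
  shows "(\<integral>\<^sup>+\<tau>. f \<tau> \<partial>masked H \<epsilon> xs \<mu> n g h s) =
    (\<integral>\<^sup>+\<tau>. f \<tau> * ennreal (1 + of_bool (g \<and> acts \<tau> = drop (h - 1) xs) * (2 * \<epsilon> * (2 * gain \<tau> - 1)))
       \<partial>masked H 0 [] \<mu> n False h s)"
  using assms
proof (induction n arbitrary: f g h s)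
  case (Suc n)
  have d: "drop (h - 1) xs = xs ! (h - 1) # drop h xs"
    using Suc.prems Cons_nth_drop_Suc[of "h - 1" xs] by simp
  show ?case
  proof (cases "n = 0")
    case True
    then have h: "h = H" using Suc.prems by simp
    have d': "drop (H - 1) xs = [xs ! (H - 1)]" using d h Suc.prems by simp
    have "(\<integral>\<^sup>+r. f [(s, a, r)] \<partial>lock_reward H \<epsilon> H g') =
        (\<integral>\<^sup>+r. f [(s, a, r)] * ennreal (1 + of_bool g' * (2 * \<epsilon> * (2 * r - 1)))
           \<partial>lock_reward H 0 H False)" for a g'
      using nn_integral_biased_coin[OF Suc.prems(5,6), of "\<lambda>x. f [(s, a, of_bool x)]"]
      by (cases g') (simp_all add: lock_reward_def)
    then show ?thesis
      unfolding True masked.simps h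
      by (simp add: d'[unfolded One_nat_def] bind_return_pmf)
  next
    case False
    then have h: "h \<noteq> H" using Suc.prems by simp
    have IH: "(\<integral>\<^sup>+\<tau>. f ((s, a, 0) # \<tau>) \<partial>masked H \<epsilon> xs \<mu> n g' (Suc h) s') =
      (\<integral>\<^sup>+\<tau>. f ((s, a, 0) # \<tau>) * ennreal (1 + of_bool (g' \<and> acts \<tau> = drop h xs) * (2 * \<epsilon> * (2 * gain \<tau> - 1)))
       \<partial>masked H 0 [] \<mu> n False (Suc h) s')" for a g' s'
      by (rule Suc.IH[where h = "Suc h", unfolded diff_Suc_1]) (use Suc.prems False in simp_all)
    show ?thesis
      by (simp add: lock_reward_def h bind_return_pmf IH d[unfolded One_nat_def])
  qed
qed simp

lemma pmf_masked:
  assumes "length xs = H" "H > 0" "0 \<le> \<epsilon>" "\<epsilon> \<le> 1/4"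
    and g: "\<tau> \<in> set_pmf (masked H 0 [] \<mu> H False 1 s) \<Longrightarrow> gain \<tau> \<in> {0, 1}"
  shows "pmf (masked H \<epsilon> xs \<mu> H True 1 s) \<tau> =
    pmf (masked H 0 [] \<mu> H False 1 s) \<tau> * (1 + of_bool (acts \<tau> = xs) * (2 * \<epsilon> * (2 * gain \<tau> - 1)))"
    (is "?p = ?q * ?w")
proof -
  have "ennreal ?p = (\<integral>\<^sup>+\<tau>'. indicator {\<tau>} \<tau>' \<partial>masked H \<epsilon> xs \<mu> H True 1 s)"
    by (simp add: emeasure_pmf_single)
  also have "\<dots> = (\<integral>\<^sup>+\<tau>'. indicator {\<tau>} \<tau>' *
      ennreal (1 + of_bool (acts \<tau>' = xs) * (2 * \<epsilon> * (2 * gain \<tau>' - 1))) \<partial>masked H 0 [] \<mu> H False 1 s)"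
    using nn_integral_masked[of 1 H H xs \<epsilon>] assms by simp
  also have "\<dots> = (\<integral>\<^sup>+\<tau>'. ennreal ?w * indicator {\<tau>} \<tau>' \<partial>masked H 0 [] \<mu> H False 1 s)"
    by (intro nn_integral_cong) (auto simp: indicator_def)
  also have "\<dots> = ennreal ?w * ennreal ?q"
    by (subst nn_integral_cmult) (simp_all add: emeasure_pmf_single)
  finally have eq: "ennreal ?p = ennreal ?w * ennreal ?q" .
  show ?thesis
  proof (cases "\<tau> \<in> set_pmf (masked H 0 [] \<mu> H False 1 s)")
    case True
    \<comment> \<open>\<open>ennreal\<close> maps negative weights to 0, so the sign has to be known
      before returning to real numbers.\<close>
    then have "?w \<ge> 0" using g assms by auto
    then show ?thesis using eq by (simp add: ennreal_mult[symmetric] mult.commute)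
  next
    case False
    then have "?q = 0" by (simp add: set_pmf_iff)
    then show ?thesis using eq by simp
  qed
qed

section \<open>Supports, finiteness, and the value of replaying the secret\<close>

lemma set_masked:
  assumes "\<tau> \<in> set_pmf (masked H 0 [] \<mu> n False h s)" "h + n = Suc H" "h > 0" "s \<in> {0, 1}"
    and "is_policy H (\<lambda>_. {0, 1}) (\<lambda>_. {0, 1}) \<mu>"
  shows "length \<tau> = n \<and> set (acts \<tau>) \<subseteq> {0, 1} \<and> (if n = 0 then gain \<tau> = 0 else gain \<tau> \<in> {0, 1})"
  using assms
proof (induction n arbitrary: h s \<tau>)
  case (Suc n)
  then obtain a r s' \<tau>' where *: "a \<in> set_pmf (\<mu> h s)" "r \<in> set_pmf (lock_reward H 0 h False)"
    "s' \<in> {0, 1}" "\<tau>' \<in> set_pmf (masked H 0 [] \<mu> n False (Suc h) s')" "\<tau> = (s, a, r) # \<tau>'"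
    by auto
  have "a \<in> {0, 1}" using *(1) Suc.prems unfolding is_policy_def by fastforce
  moreover have "r \<in> {0, 1}" "n \<noteq> 0 \<Longrightarrow> r = 0"
    using *(2) Suc.prems by (auto simp: lock_reward_def split: if_splits)
  moreover have "length \<tau>' = n \<and> set (acts \<tau>') \<subseteq> {0, 1} \<and>
      (if n = 0 then gain \<tau>' = 0 else gain \<tau>' \<in> {0, 1})"
    by (rule Suc.IH[OF *(4)]) (use Suc.prems(2,3,5) *(3) in simp_all)
  ultimately show ?case unfolding *(5) by (cases "n = 0") auto
qed simp

lemma finite_set_lock_reward [simp]: "finite (set_pmf (lock_reward H \<epsilon> h g))"
  by (simp add: lock_reward_def)

lemma finite_set_masked:
  assumes "is_policy H (\<lambda>_. {0, 1}) (\<lambda>_. {0, 1}) \<mu>" "h + n = Suc H" "h > 0" "s \<in> {0, 1}"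
  shows "finite (set_pmf (masked H \<epsilon> xs \<mu> n g h s))"
  using assms
proof (induction n arbitrary: g h s)
  case (Suc n)
  have "finite (set_pmf (\<mu> h s))"
    by (rule finite_subset[of _ "{0, 1}"]) (use Suc.prems in \<open>auto simp: is_policy_def\<close>)
  moreover have "finite (set_pmf (masked H \<epsilon> xs \<mu> n g' (Suc h) s'))" if "s' \<in> set_pmf coin" for g' s'
    using Suc that by simp
  ultimately show ?case by simp
qed simp

lemma finite_set_rollout_lock:
  assumes "is_policy H (\<lambda>_. {0, 1}) (\<lambda>_. {0, 1}) \<mu>" "h + n = Suc H" "h > 0" "s \<in> {0, 1}"
    and "\<And>i. b i \<in> {0, 1}"
  shows "finite (set_pmf (rollout (lock H \<epsilon> xs b) \<mu> n h s))"
  using assms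
proof (induction n arbitrary: h s)
  case (Suc n)
  have "finite (set_pmf (\<mu> h s))"
    by (rule finite_subset[of _ "{0, 1}"]) (use Suc.prems in \<open>auto simp: is_policy_def\<close>)
  moreover have "finite (set_pmf (rollout (lock H \<epsilon> xs b) \<mu> n (Suc h) s'))"
    if "s' \<in> set_pmf (trans (lock H \<epsilon> xs b) h s a)" for s' a
  proof -
    have "b (Suc h) \<in> {0, 1}" using Suc.prems by blast
    then have "s' \<in> {0, 1}" using that by (auto simp: lock_def split: if_splits)
    then show ?thesis using Suc by simp
  qed
  ultimately show ?case by (simp add: lock_def)
qed simp

lemma policy_value_lock_nonneg: "policy_value H s (lock H \<epsilon> xs b) \<mu> \<ge> 0"
proof -
  have "gain \<tau> \<ge> 0" if "\<tau> \<in> set_pmf (rollout (lock H \<epsilon> xs b) \<mu> n h s)" for n h s \<tau>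
    using that
  proof (induction n arbitrary: h s \<tau>)
    case (Suc n)
    then obtain a r s' \<tau>' where "r \<in> set_pmf (reward (lock H \<epsilon> xs b) h s a)"
      "\<tau>' \<in> set_pmf (rollout (lock H \<epsilon> xs b) \<mu> n (Suc h) s')" "\<tau> = (s, a, r) # \<tau>'"
      by auto
    moreover from this(1) have "r \<ge> 0"
      by (auto simp: lock_def lock_reward_def split: if_splits)
    ultimately show ?case using Suc.IH[of \<tau>' "Suc h" s'] by simp
  qed simp
  then show ?thesis
    unfolding policy_value_def episode_def gain_def[symmetric]
    by (intro integral_nonneg_AE) (auto simp: AE_measure_pmf_iff)
qed

lemma is_mdp_lock:
  assumes "\<And>i. b i \<in> {0, 1}" "0 \<le> \<epsilon>" "\<epsilon> \<le> 1/2"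
  shows "is_mdp H (\<lambda>_. {0, 1}) (\<lambda>_. {0, 1}) (lock H \<epsilon> xs b)"
proof -
  have "set_pmf (trans (lock H \<epsilon> xs b) h s a) \<subseteq> {0, 1}" for h s a
  proof -
    have "(if c then b (Suc h) else 1 - b (Suc h)) \<in> {0, 1}" for c
      using assms(1)[of "Suc h"] by (cases c) auto
    then show ?thesis
      unfolding lock_def mdp.simps set_return_pmf by (simp only: insert_subset empty_subsetI simp_thms)
  qed
  moreover have "set_pmf (lock_reward H \<epsilon> h g) \<subseteq> {0..1}" for h g
    by (auto simp: lock_reward_def)
  then have "set_pmf (reward (lock H \<epsilon> xs b) h s a) \<subseteq> {0..1}" for h s a
    unfolding lock_def mdp.simps .
  ultimately show ?thesis unfolding is_mdp_def by (intro conjI ballI)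
qed

definition replay :: "nat list \<Rightarrow> (nat, nat) policy" where
  "replay xs h s = return_pmf (xs ! (h - 1))"

lemma is_policy_replay:
  "set xs \<subseteq> {0, 1} \<Longrightarrow> length xs = H \<Longrightarrow> is_policy H (\<lambda>_. {0, 1}) (\<lambda>_. {0, 1}) (replay xs)"
proof -
  assume xs: "set xs \<subseteq> {0, 1}" "length xs = H"
  have "set_pmf (replay xs h s) \<subseteq> {0, 1}" if "h \<in> {1..H}" for h s
  proof -
    have "xs ! (h - 1) \<in> set xs" by (rule nth_mem) (use that xs in auto)
    then show ?thesis unfolding replay_def set_return_pmf using subsetD[OF xs(1)]
      by (simp only: insert_subset empty_subsetI simp_thms)
  qed
  then show ?thesis unfolding is_policy_def by (intro ballI)
qed

text \<open>Correct actions lead from \<open>b h\<close> to \<open>b (Suc h)\<close> under every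
  labelling, so one policy that never looks at the state earns the full gap in all episodes although
  the MDPs change.\<close>

lemma policy_value_replay:
  assumes "H > 0" "b 1 = 0" "0 \<le> \<epsilon>" "\<epsilon> \<le> 1/2"
  shows "policy_value H 0 (lock H \<epsilon> xs b) (replay xs) = 1/2 + \<epsilon>"
proof -
  have "map_pmf gain (rollout (lock H \<epsilon> xs b) (replay xs) n h (b h)) = lock_reward H \<epsilon> H True"
    if "n > 0" "h + n = Suc H" for n h
    using that
  proof (induction n arbitrary: h)
    case (Suc n)
    show ?case
    proof (cases "n = 0")
      case True
      then show ?thesis using Suc.prems
        by (simp add: lock_def replay_def bind_return_pmf map_bind_pmf bind_return_pmf')
    next
      case False
      then have "lock_reward H \<epsilon> h True = return_pmf 0" using Suc.prems by (simp add: lock_reward_def)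
      moreover have "map_pmf gain (rollout (lock H \<epsilon> xs b) (replay xs) n (Suc h) (b (Suc h))) =
          lock_reward H \<epsilon> H True" using Suc False by simp
      moreover have "rollout (lock H \<epsilon> xs b) (replay xs) (Suc n) h (b h) = do {
          r \<leftarrow> lock_reward H \<epsilon> h True;
          \<tau> \<leftarrow> rollout (lock H \<epsilon> xs b) (replay xs) n (Suc h) (b (Suc h));
          return_pmf ((b h, xs ! (h - 1), r) # \<tau>) }"
        by (simp add: lock_def replay_def bind_return_pmf)
      ultimately show ?thesis
        by (simp add: bind_assoc_pmf bind_return_pmf map_pmf_def del: rollout.simps)
    qed
  qed simp
  from this[of H 1] have *: "map_pmf gain (episode H 0 (lock H \<epsilon> xs b) (replay xs)) = lock_reward H \<epsilon> H True"
    using assms by (simp add: episode_def)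
  have "policy_value H 0 (lock H \<epsilon> xs b) (replay xs) =
      measure_pmf.expectation (map_pmf gain (episode H 0 (lock H \<epsilon> xs b) (replay xs))) (\<lambda>r. r)"
    by (simp add: policy_value_def gain_def)
  also have "\<dots> = 1/2 + \<epsilon>"
    unfolding * lock_reward_def using assms by simp
  finally show ?thesis .
qed

section \<open>Averaging over the adversary\<close>

lemma history_cong:
  "(\<And>j. j \<in> {1..k} \<Longrightarrow> Ms j = Ms' j) \<Longrightarrow> history H s0 Ms \<alpha> k = history H s0 Ms' \<alpha> k"
  by (induction k) (auto intro!: bind_pmf_cong)

text \<open>The MDP of the next episode is independent of the observed history, so it can be drawn
  within that episode; averaging it out leaves one kernel from histories to trajectories.\<close>

lemma history_mixture:
  assumes "k \<le> K"
  shows "Pi_pmf {1..K} d (\<lambda>_. D) \<bind> (\<lambda>Ms. history H s0 Ms \<alpha> k) =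
    feedback (\<lambda>hist. D \<bind> (\<lambda>M. episode H s0 M (\<alpha> hist))) k"
  using assms
proof (induction k)
  case (Suc k)
  define R where "R = Pi_pmf ({1..K} - {Suc k}) d (\<lambda>_. D)"
  have "{1..K} = insert (Suc k) ({1..K} - {Suc k})" using Suc.prems by auto
  then have P: "Pi_pmf {1..K} d (\<lambda>_. D) = do {M \<leftarrow> D; Ms \<leftarrow> R; return_pmf (Ms(Suc k := M))}"
    unfolding R_def by (metis Pi_pmf_insert' finite_Diff finite_atLeastAtMost Diff_iff singletonI)
  have hist: "history H s0 (Ms(Suc k := M)) \<alpha> k = history H s0 Ms \<alpha> k" for Ms M
    by (rule history_cong) auto
  \<comment> \<open>The first \<open>k\<close> episodes do not see coordinate \<open>Suc k\<close>,
    so integrating it out in the induction hypothesis leaves \<open>R\<close>.\<close>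
  have past: "R \<bind> (\<lambda>Ms. history H s0 Ms \<alpha> k) =
      feedback (\<lambda>hist. D \<bind> (\<lambda>M. episode H s0 M (\<alpha> hist))) k"
    using Suc.IH Suc.prems by (simp only: P bind_assoc_pmf bind_return_pmf hist bind_pmf_const Suc_leD)
  have "Pi_pmf {1..K} d (\<lambda>_. D) \<bind> (\<lambda>Ms. history H s0 Ms \<alpha> (Suc k)) =
      D \<bind> (\<lambda>M. R \<bind> (\<lambda>Ms. history H s0 Ms \<alpha> k) \<bind> (\<lambda>hist.
        episode H s0 M (\<alpha> hist) \<bind> (\<lambda>\<tau>. return_pmf (hist @ [\<tau>]))))"
    by (simp only: P bind_assoc_pmf bind_return_pmf hist history.simps fun_upd_same)
  also have "\<dots> = feedback (\<lambda>hist. D \<bind> (\<lambda>M. episode H s0 M (\<alpha> hist))) (Suc k)"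
    unfolding past by (subst bind_commute_pmf) (simp add: bind_assoc_pmf)
  finally show ?case .
qed simp

text \<open>
  Integrability is not assumed: a non-integrable summand has Bochner integral 0, and the
  summands are nonnegative, so dropping it preserves the bound.
\<close>
lemma (in prob_space) sum_integral_le:
  fixes f :: "'j \<Rightarrow> 'a \<Rightarrow> real"
  assumes "finite J" "\<And>j x. j \<in> J \<Longrightarrow> x \<in> space M \<Longrightarrow> 0 \<le> f j x"
    and "\<And>x. x \<in> space M \<Longrightarrow> (\<Sum>j\<in>J. f j x) \<le> C"
  shows "(\<Sum>j\<in>J. \<integral>x. f j x \<partial>M) \<le> C"
proof -
  define J' where "J' = {j \<in> J. integrable M (f j)}"
  have "(\<Sum>j\<in>J. \<integral>x. f j x \<partial>M) = (\<Sum>j\<in>J'. \<integral>x. f j x \<partial>M)"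
    unfolding J'_def using assms(1)
    by (intro sum.mono_neutral_right) (auto simp: not_integrable_integral_eq)
  also have "\<dots> = (\<integral>x. (\<Sum>j\<in>J'. f j x) \<partial>M)"
    by (subst Bochner_Integration.integral_sum) (auto simp: J'_def)
  also have "\<dots> \<le> (\<integral>x. C \<partial>M)"
  proof (rule integral_mono)
    fix x assume x: "x \<in> space M"
    have "(\<Sum>j\<in>J'. f j x) \<le> (\<Sum>j\<in>J. f j x)"
      using assms x by (intro sum_mono2) (auto simp: J'_def)
    then show "(\<Sum>j\<in>J'. f j x) \<le> C" using assms(3)[OF x] by simp
  qed (auto simp: J'_def)
  also have "\<dots> = C" by (simp add: prob_space)
  finally show ?thesis .
qed

section \<open>The learner's average value against a random adversary\<close>

definition secrets :: "nat \<Rightarrow> nat list set" where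
  "secrets H = {xs. set xs \<subseteq> {0, 1} \<and> length xs = H}"

lemma finite_secrets: "finite (secrets H)"
  unfolding secrets_def by (rule finite_lists_length_eq) simp

lemma card_secrets: "card (secrets H) = 2 ^ H"
  unfolding secrets_def by (subst card_lists_length_eq) (simp_all add: numeral_2_eq_2)

definition random_lock :: "nat \<Rightarrow> real \<Rightarrow> nat list \<Rightarrow> (nat, nat) mdp pmf" where
  "random_lock H \<epsilon> xs = map_pmf (lock H \<epsilon> xs) (labels H 1)"

definition adversary :: "nat \<Rightarrow> nat \<Rightarrow> real \<Rightarrow> nat list \<Rightarrow> (nat \<Rightarrow> (nat, nat) mdp) pmf" where
  "adversary H K \<epsilon> xs = Pi_pmf {1..K} undefined (\<lambda>_. random_lock H \<epsilon> xs)"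

lemma set_adversary:
  assumes "Ms \<in> set_pmf (adversary H K \<epsilon> xs)" "k \<in> {1..K}"
  shows "\<exists>b. Ms k = lock H \<epsilon> xs b \<and> (\<forall>i. b i \<in> {0, 1}) \<and> b 1 = 0"
proof -
  have "Ms k \<in> set_pmf (random_lock H \<epsilon> xs)"
    using assms by (auto simp: adversary_def set_Pi_pmf PiE_dflt_def)
  then obtain b where b: "b \<in> set_pmf (labels H 1)" "Ms k = lock H \<epsilon> xs b"
    by (auto simp: random_lock_def)
  show ?thesis
    by (intro exI[of _ b] conjI allI b(2) set_labels[OF b(1)] labels_outside[OF b(1)] order_refl)
qed

lemma finite_set_adversary: "finite (set_pmf (adversary H K \<epsilon> xs))"
  unfolding adversary_def set_Pi_pmf[OF finite_atLeastAtMost]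
  by (rule finite_PiE_dflt) (simp_all add: random_lock_def finite_set_labels)

lemma finite_set_episode_adversary:
  assumes "Ms \<in> set_pmf (adversary H K \<epsilon> xs)" "k \<in> {1..K}"
    and "is_policy H (\<lambda>_. {0, 1}) (\<lambda>_. {0, 1}) \<mu>"
  shows "finite (set_pmf (episode H 0 (Ms k) \<mu>))"
proof -
  obtain b where b: "Ms k = lock H \<epsilon> xs b" "\<forall>i. b i \<in> {0, 1}"
    using set_adversary[OF assms(1,2)] by blast
  show ?thesis unfolding b(1) episode_def
    by (rule finite_set_rollout_lock[OF assms(3)]) (use b(2) in simp_all)
qed

lemma finite_set_history_adversary:
  assumes "Ms \<in> set_pmf (adversary H K \<epsilon> xs)" "k \<le> K"
    and "\<And>hist. is_policy H (\<lambda>_. {0, 1}) (\<lambda>_. {0, 1}) (\<alpha> hist)"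
  shows "finite (set_pmf (history H 0 Ms \<alpha> k))"
  using assms(2)
proof (induction k)
  case (Suc k)
  then have "finite (set_pmf (episode H 0 (Ms (Suc k)) (\<alpha> hist)))" for hist
    by (intro finite_set_episode_adversary[OF assms(1)] assms(3)) auto
  with Suc show ?case by simp
qed simp

text \<open>Turns the value into the reward observed in one further episode, the quantity bounded by
  \<open>average_reward_le\<close>.\<close>

lemma expectation_policy_value:
  assumes "Ms \<in> set_pmf (adversary H K \<epsilon> xs)" "Suc k \<le> K"
    and "\<And>hist. is_policy H (\<lambda>_. {0, 1}) (\<lambda>_. {0, 1}) (\<alpha> hist)"
  shows "measure_pmf.expectation (history H 0 Ms \<alpha> k)
      (\<lambda>hist. policy_value H 0 (Ms (Suc k)) (\<alpha> hist)) =
    measure_pmf.expectation (history H 0 Ms \<alpha> (Suc k)) (\<lambda>hist. gain (last hist))"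
proof -
  have fin: "finite (set_pmf (episode H 0 (Ms (Suc k)) (\<alpha> hist)))" for hist
    by (intro finite_set_episode_adversary[OF assms(1)] assms(3)) (use assms(2) in auto)
  have "finite (set_pmf (history H 0 Ms \<alpha> k))"
    by (rule finite_set_history_adversary[OF assms(1) _ assms(3)]) (use assms(2) in simp)
  then show ?thesis
    by (simp add: expectation_bind_finite fin policy_value_def gain_def)
qed

lemma average_reward_adversary:
  assumes "H > 0" "0 < \<epsilon>" "\<epsilon> \<le> 1/4" "Suc k \<le> K"
    and pol: "\<And>hist. is_policy H (\<lambda>_. {0, 1}) (\<lambda>_. {0, 1}) (\<alpha> hist)"
  shows "(\<Sum>xs\<in>secrets H. measure_pmf.expectation (adversary H K \<epsilon> xs) (\<lambda>Ms.
      measure_pmf.expectation (history H 0 Ms \<alpha> k) (\<lambda>hist. policy_value H 0 (Ms (Suc k)) (\<alpha> hist))))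
    \<le> 2 ^ H / 2 + \<epsilon> * (1 + 2 ^ H / 3 + 16 * \<epsilon>\<^sup>2 * k)"
proof -
  define Q where "Q = (\<lambda>xs hist. masked H \<epsilon> xs (\<alpha> hist) H True 1 0)"
  note set_masked' = set_masked[where n = H and h = 1 and s = 0, OF _ _ _ _ pol, simplified]
  \<comment> \<open>Arms are secrets and observations are whole trajectories; the reference problem
    is the masked law with gap 0.\<close>
  interpret hidden_arm "secrets H" "\<lambda>xs \<tau>. acts \<tau> = xs" gain \<epsilon>
    "\<lambda>hist. masked H 0 [] (\<alpha> hist) H False 1 0" Q
  proof
    show "finite (set_pmf (masked H 0 [] (\<alpha> hist) H False 1 0))" for hist
      by (rule finite_set_masked[OF pol]) auto
    show gain: "gain \<tau> \<in> {0, 1}" if "\<tau> \<in> set_pmf (masked H 0 [] (\<alpha> hist) H False 1 0)" for \<tau> hist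
      using set_masked' that assms(1) by fastforce
    show "(\<Sum>xs\<in>secrets H. of_bool (acts \<tau> = xs)) = (1::real)"
      if "\<tau> \<in> set_pmf (masked H 0 [] (\<alpha> hist) H False 1 0)" for \<tau> hist
    proof -
      have "acts \<tau> \<in> secrets H" using set_masked'[of \<tau> hist] that by (simp add: secrets_def acts_def)
      then show ?thesis by (simp add: of_bool_def finite_secrets)
    qed
    show "pmf (Q xs hist) \<tau> = pmf (masked H 0 [] (\<alpha> hist) H False 1 0) \<tau> *
        (1 + of_bool (acts \<tau> = xs) * (2 * \<epsilon> * (2 * gain \<tau> - 1)))" if "xs \<in> secrets H" for xs hist \<tau>
      unfolding Q_def
      by (rule pmf_masked) (use that assms gain in \<open>auto simp: secrets_def\<close>)
  qed (use assms finite_secrets in auto)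
  have "measure_pmf.expectation (adversary H K \<epsilon> xs) (\<lambda>Ms.
      measure_pmf.expectation (history H 0 Ms \<alpha> k) (\<lambda>hist. policy_value H 0 (Ms (Suc k)) (\<alpha> hist))) =
    measure_pmf.expectation (feedback (Q xs) (Suc k)) (\<lambda>hist. gain (last hist))" for xs
  proof -
    have "measure_pmf.expectation (adversary H K \<epsilon> xs) (\<lambda>Ms.
        measure_pmf.expectation (history H 0 Ms \<alpha> k) (\<lambda>hist. policy_value H 0 (Ms (Suc k)) (\<alpha> hist))) =
      measure_pmf.expectation (adversary H K \<epsilon> xs) (\<lambda>Ms.
        measure_pmf.expectation (history H 0 Ms \<alpha> (Suc k)) (\<lambda>hist. gain (last hist)))"
      by (rule expectation_cong_pmf) (rule expectation_policy_value[OF _ assms(4) pol])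
    also have "\<dots> = measure_pmf.expectation (adversary H K \<epsilon> xs \<bind> (\<lambda>Ms. history H 0 Ms \<alpha> (Suc k)))
        (\<lambda>hist. gain (last hist))"
      by (rule expectation_bind_finite[symmetric, OF finite_set_adversary])
         (rule finite_set_history_adversary[OF _ assms(4) pol])
    also have "adversary H K \<epsilon> xs \<bind> (\<lambda>Ms. history H 0 Ms \<alpha> (Suc k)) =
        feedback (\<lambda>hist. random_lock H \<epsilon> xs \<bind> (\<lambda>M. episode H 0 M (\<alpha> hist))) (Suc k)"
      unfolding adversary_def by (rule history_mixture[OF assms(4)])
    also have "(\<lambda>hist. random_lock H \<epsilon> xs \<bind> (\<lambda>M. episode H 0 M (\<alpha> hist))) = Q xs"
      unfolding Q_def random_lock_def bind_map_pmf by (rule ext) (rule average_episode)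
    finally show ?thesis .
  qed
  then show ?thesis using average_reward_le[of k] by (simp only: card_secrets of_nat_power of_nat_numeral)
qed

lemma average_learner_value:
  assumes "is_algorithm H (\<lambda>_. {0, 1}) (\<lambda>_. {0, 1}) \<A>" "H > 0" "0 < \<epsilon>" "\<epsilon> \<le> 1/4"
  shows "(\<Sum>xs\<in>secrets H. measure_pmf.expectation (adversary H K \<epsilon> xs)
      (\<lambda>Ms. \<Sum>k=1..K. learner_value H 0 Ms \<A> k))
    \<le> K * (2 ^ H / 2 + \<epsilon> * (1 + 2 ^ H / 3 + 16 * \<epsilon>\<^sup>2 * K))"
proof -
  interpret prob_space \<A> using assms(1) by (simp add: is_algorithm_def)
  have pol: "is_policy H (\<lambda>_. {0, 1}) (\<lambda>_. {0, 1}) (\<alpha> hist)" if "\<alpha> \<in> space \<A>" for \<alpha> hist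
    using assms(1) that by (simp add: is_algorithm_def)
  define P where "P = adversary H K \<epsilon>"
  define G where "G = (\<lambda>(Ms :: nat \<Rightarrow> (nat, nat) mdp) k \<alpha>. measure_pmf.expectation (history H 0 Ms \<alpha> k)
    (\<lambda>hist. policy_value H 0 (Ms (Suc k)) (\<alpha> hist)))"
  have E: "measure_pmf.expectation (P xs) f = (\<Sum>Ms\<in>set_pmf (P xs). pmf (P xs) Ms * f Ms)"
    for xs and f :: "_ \<Rightarrow> real"
    unfolding P_def by (subst integral_measure_pmf[OF finite_set_adversary]) auto
  \<comment> \<open>One finite index set for secret, adversary and episode, so that
    \<open>sum_integral_le\<close> exchanges all the sums with the integral over the algorithm at
    once.\<close>
  define J where "J = (SIGMA xs:secrets H. set_pmf (P xs) \<times> {..<K})"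
  have fin: "finite J" "finite (set_pmf (P xs) \<times> {..<K})" for xs
    unfolding J_def P_def by (intro finite_SigmaI finite_secrets finite_set_adversary; simp)+
  have unfold_J: "(\<Sum>xs\<in>secrets H. measure_pmf.expectation (P xs) (\<lambda>Ms. \<Sum>k<K. g Ms k)) =
      (\<Sum>(xs, Ms, k)\<in>J. pmf (P xs) Ms * g Ms k)" for g :: "_ \<Rightarrow> nat \<Rightarrow> real"
    unfolding E J_def sum_distrib_left sum.cartesian_product
    by (subst sum.Sigma) (use fin finite_secrets in \<open>auto simp: case_prod_beta\<close>)
  \<comment> \<open>Episode \<open>k\<close> has \<open>k - 1\<close> predecessors, hence the shift
    from \<open>1..K\<close> to \<open>k < K\<close>.\<close>
  have "(\<Sum>k=1..K. learner_value H 0 Ms \<A> k) = (\<Sum>k<K. \<integral>\<alpha>. G Ms k \<alpha> \<partial>\<A>)" for Ms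
    unfolding learner_value_def G_def by (simp only: sum_bounds_lt_plus1[symmetric] diff_Suc_1)
  then have "(\<Sum>xs\<in>secrets H. measure_pmf.expectation (P xs)
      (\<lambda>Ms. \<Sum>k=1..K. learner_value H 0 Ms \<A> k)) =
    (\<Sum>j\<in>J. \<integral>\<alpha>. (case j of (xs, Ms, k) \<Rightarrow> pmf (P xs) Ms * G Ms k \<alpha>) \<partial>\<A>)"
    by (simp add: unfold_J case_prod_beta)
  also have "\<dots> \<le> (\<Sum>k<K. 2 ^ H / 2 + \<epsilon> * (1 + 2 ^ H / 3 + 16 * \<epsilon>\<^sup>2 * K))"
  proof (rule sum_integral_le[OF fin(1)])
    fix j \<alpha> assume j: "j \<in> J" and \<alpha>: "\<alpha> \<in> space \<A>"
    obtain xs Ms k where j': "j = (xs, Ms, k)" by (cases j)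
    then have "Ms \<in> set_pmf (P xs)" "Suc k \<in> {1..K}" using j by (auto simp: J_def)
    then obtain b where "Ms (Suc k) = lock H \<epsilon> xs b" unfolding P_def using set_adversary by blast
    then have "G Ms k \<alpha> \<ge> 0"
      unfolding G_def by (intro integral_nonneg_AE) (simp add: policy_value_lock_nonneg)
    then show "0 \<le> (case j of (xs, Ms, k) \<Rightarrow> pmf (P xs) Ms * G Ms k \<alpha>)"
      by (simp add: j')
  next
    fix \<alpha> assume \<alpha>: "\<alpha> \<in> space \<A>"
    have "(\<Sum>j\<in>J. case j of (xs, Ms, k) \<Rightarrow> pmf (P xs) Ms * G Ms k \<alpha>) =
        (\<Sum>xs\<in>secrets H. measure_pmf.expectation (P xs) (\<lambda>Ms. \<Sum>k<K. G Ms k \<alpha>))"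
      by (rule unfold_J[symmetric])
    also have "\<dots> = (\<Sum>k<K. \<Sum>xs\<in>secrets H. measure_pmf.expectation (P xs) (\<lambda>Ms. G Ms k \<alpha>))"
      by (subst sum.swap, intro sum.cong refl Bochner_Integration.integral_sum
          integrable_measure_pmf_finite) (simp add: P_def finite_set_adversary)
    also have "\<dots> \<le> (\<Sum>k<K. 2 ^ H / 2 + \<epsilon> * (1 + 2 ^ H / 3 + 16 * \<epsilon>\<^sup>2 * K))"
    proof (rule sum_mono)
      fix k assume k: "k \<in> {..<K}"
      have "(\<Sum>xs\<in>secrets H. measure_pmf.expectation (P xs) (\<lambda>Ms. G Ms k \<alpha>))
          \<le> 2 ^ H / 2 + \<epsilon> * (1 + 2 ^ H / 3 + 16 * \<epsilon>\<^sup>2 * k)"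
        unfolding G_def P_def
        by (rule average_reward_adversary) (use assms pol[OF \<alpha>] k in auto)
      also have "\<dots> \<le> 2 ^ H / 2 + \<epsilon> * (1 + 2 ^ H / 3 + 16 * \<epsilon>\<^sup>2 * K)"
        using k assms by (intro add_left_mono mult_left_mono) auto
      finally show "(\<Sum>xs\<in>secrets H. measure_pmf.expectation (P xs) (\<lambda>Ms. G Ms k \<alpha>))
          \<le> 2 ^ H / 2 + \<epsilon> * (1 + 2 ^ H / 3 + 16 * \<epsilon>\<^sup>2 * K)" .
    qed
    finally show "(\<Sum>j\<in>J. case j of (xs, Ms, k) \<Rightarrow> pmf (P xs) Ms * G Ms k \<alpha>)
        \<le> (\<Sum>k<K. 2 ^ H / 2 + \<epsilon> * (1 + 2 ^ H / 3 + 16 * \<epsilon>\<^sup>2 * K))" .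
  qed
  finally show ?thesis by (simp add: P_def)
qed

text \<open>Probabilistic method: some secret and label draw are at least as bad for the learner as
  the average. The secret is returned along with \<open>Ms\<close> because the comparator has to
  replay it.\<close>

lemma hard_instance:
  assumes "is_algorithm H (\<lambda>_. {0, 1}) (\<lambda>_. {0, 1}) \<A>" "H > 0" "0 < \<epsilon>" "\<epsilon> \<le> 1/4"
  obtains xs Ms where "xs \<in> secrets H" "Ms \<in> set_pmf (adversary H K \<epsilon> xs)"
    "(\<Sum>k=1..K. learner_value H 0 Ms \<A> k) \<le> K * (1/2 + \<epsilon> * (1 / 2 ^ H + 1/3 + 16 * \<epsilon>\<^sup>2 * K / 2 ^ H))"
proof -
  define C where "C = K * (1/2 + \<epsilon> * (1 / 2 ^ H + 1/3 + 16 * \<epsilon>\<^sup>2 * K / 2 ^ H))"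
  define V where "V = (\<lambda>Ms. \<Sum>k=1..K. learner_value H 0 Ms \<A> k)"
  have NC: "K * (2 ^ H / 2 + \<epsilon> * (1 + 2 ^ H / 3 + 16 * \<epsilon>\<^sup>2 * K)) = 2 ^ H * C"
    by (simp add: C_def field_simps)
  have "\<exists>xs\<in>secrets H. \<exists>Ms\<in>set_pmf (adversary H K \<epsilon> xs). V Ms \<le> C"
  proof (rule ccontr)
    assume "\<not> ?thesis"
    then have gt: "C < V Ms" if "xs \<in> secrets H" "Ms \<in> set_pmf (adversary H K \<epsilon> xs)" for xs Ms
      using that by force
    have "secrets H \<noteq> {}" using card_secrets[of H] by auto
    have "C < measure_pmf.expectation (adversary H K \<epsilon> xs) V" if "xs \<in> secrets H" for xs
    proof -
      let ?P = "adversary H K \<epsilon> xs"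
      \<comment> \<open>Passing through the minimum over the finite support keeps the inequality
        strict, which monotonicity of the expectation alone would not.\<close>
      define m where "m = Min (V ` set_pmf ?P)"
      have "m \<in> V ` set_pmf ?P"
        unfolding m_def by (intro Min_in) (auto simp: finite_set_adversary set_pmf_not_empty)
      then have "C < m" using gt[OF that] by auto
      also have "m = measure_pmf.expectation ?P (\<lambda>_. m)" by simp
      also have "\<dots> \<le> measure_pmf.expectation ?P V"
        unfolding m_def by (intro expectation_mono_finite finite_set_adversary Min_le) (auto simp: finite_set_adversary)
      finally show ?thesis .
    qed
    then have "(\<Sum>xs\<in>secrets H. C) < (\<Sum>xs\<in>secrets H. measure_pmf.expectation (adversary H K \<epsilon> xs) V)"
      using \<open>secrets H \<noteq> {}\<close> finite_secrets by (intro sum_strict_mono) auto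
    also have "\<dots> \<le> 2 ^ H * C"
      using average_learner_value[OF assms, of K] unfolding NC V_def .
    finally show False by (simp add: card_secrets)
  qed
  then show ?thesis using that unfolding V_def C_def by blast
qed

section \<open>Choice of the gap and the regret bound\<close>

theorem lemma1:
  shows "\<exists>c::real. c > 0 \<and>
    (\<forall>H K :: nat. H \<ge> 2 \<longrightarrow> K \<ge> 1 \<longrightarrow>
      (\<exists>(S :: nat \<Rightarrow> nat set) (A :: nat \<Rightarrow> nat set) (s0 :: nat) (\<M> :: (nat, nat) mdp set).
        (\<forall>h\<in>{1..H}. finite (S h) \<and> S h \<noteq> {} \<and> card (S h) \<le> 2) \<and>
        (\<forall>h\<in>{1..H}. finite (A h) \<and> A h \<noteq> {} \<and> card (A h) \<le> 2) \<and>
        s0 \<in> S 1 \<and>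
        (\<forall>M\<in>\<M>. is_mdp H S A M) \<and>
        (\<forall>\<A> :: (nat, nat) det_algorithm measure. is_algorithm H S A \<A> \<longrightarrow>
          (SUP Ms \<in> {1..K} \<rightarrow> \<M>. SUP \<mu> \<in> {\<mu>. is_policy H S A \<mu>}.
             ereal (\<Sum>k=1..K. policy_value H s0 (Ms k) \<mu> - learner_value H s0 Ms \<A> k))
          \<ge> ereal (c * min (sqrt (2 ^ H * real K)) (real K)))))"
proof (intro exI[of _ "1/64::real"] conjI allI impI)
  fix H K :: nat
  assume HK: "H \<ge> 2" "K \<ge> 1"
  define B :: "nat \<Rightarrow> nat set" where "B = (\<lambda>_. {0, 1})"
  \<comment> \<open>The family has to be fixed before the algorithm; taking all MDPs on these spaces
    includes the locks for every secret and every labelling.\<close>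
  define \<M> :: "(nat, nat) mdp set" where "\<M> = {M. is_mdp H B B M}"
  \<comment> \<open>The square root keeps the divergence term
    \<open>16 * \<epsilon>\<^sup>2 * K / 2 ^ H\<close> at most 1/16; the minimum with 1 keeps
    \<epsilon> below 1/4.\<close>
  define \<epsilon> :: real where "\<epsilon> = min 1 (sqrt (2 ^ H / K)) / 16"
  have "ereal (1/64 * min (sqrt (2 ^ H * real K)) (real K)) \<le>
      (SUP Ms \<in> {1..K} \<rightarrow> \<M>. SUP \<mu> \<in> {\<mu>. is_policy H B B \<mu>}.
         ereal (\<Sum>k=1..K. policy_value H 0 (Ms k) \<mu> - learner_value H 0 Ms \<A> k))"
    if alg: "is_algorithm H B B \<A>" for \<A>
  proof -
    have eps: "0 < \<epsilon>" "\<epsilon> \<le> 1/4" and HK': "H > 0" "real K > 0" using HK by (auto simp: \<epsilon>_def)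
    obtain xs Ms where xs: "xs \<in> secrets H" and Ms: "Ms \<in> set_pmf (adversary H K \<epsilon> xs)"
      and le: "(\<Sum>k=1..K. learner_value H 0 Ms \<A> k) \<le>
        K * (1/2 + \<epsilon> * (1 / 2 ^ H + 1/3 + 16 * \<epsilon>\<^sup>2 * K / 2 ^ H))"
      using hard_instance[OF alg[unfolded B_def] HK'(1) eps] by metis
    have "Ms k \<in> \<M>" if k: "k \<in> {1..K}" for k
    proof -
      obtain b where b: "Ms k = lock H \<epsilon> xs b" "\<forall>i. b i \<in> {0, 1}"
        using set_adversary[OF Ms k] by blast
      show ?thesis
        unfolding \<M>_def B_def mem_Collect_eq b(1) by (rule is_mdp_lock[OF spec[OF b(2)]]) (use eps in auto)
    qed
    then have Ms_in: "Ms \<in> {1..K} \<rightarrow> \<M>" by blast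
    have pol: "is_policy H B B (replay xs)"
      using is_policy_replay xs unfolding B_def secrets_def by blast
    have val: "policy_value H 0 (Ms k) (replay xs) = 1/2 + \<epsilon>" if k: "k \<in> {1..K}" for k
    proof -
      obtain b where b: "Ms k = lock H \<epsilon> xs b" "b 1 = 0"
        using set_adversary[OF Ms k] by blast
      show ?thesis
        unfolding b(1) by (rule policy_value_replay) (use HK' eps b(2) in auto)
    qed
    \<comment> \<open>\<open>H \<ge> 2\<close> supplies the 1/4 in 1/4 + 1/3 + 1/16 \<le> 3/4, which
      bounds the fraction of the gap that the learner can collect.\<close>
    have "(2::real) ^ 2 \<le> 2 ^ H" using HK by (intro power_increasing) auto
    then have "1 / 2 ^ H \<le> (1/4::real)" by (simp add: field_simps)
    moreover have "16 * \<epsilon>\<^sup>2 * K / 2 ^ H \<le> 1/16"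
    proof -
      have "(min 1 (sqrt (2 ^ H / K)))\<^sup>2 \<le> (sqrt (2 ^ H / K))\<^sup>2"
        by (intro power_mono) auto
      then have "\<epsilon>\<^sup>2 \<le> 2 ^ H / K / 256" by (simp add: \<epsilon>_def power_divide)
      then show ?thesis using HK' by (simp add: field_simps)
    qed
    ultimately have "1 / 2 ^ H + 1/3 + 16 * \<epsilon>\<^sup>2 * K / 2 ^ H \<le> (3/4::real)" by linarith
    then have "\<epsilon> * (1 / 2 ^ H + 1/3 + 16 * \<epsilon>\<^sup>2 * K / 2 ^ H) \<le> \<epsilon> * (3/4)"
      using eps by (intro mult_left_mono) auto
    then have "K * (1/2 + \<epsilon> * (1 / 2 ^ H + 1/3 + 16 * \<epsilon>\<^sup>2 * K / 2 ^ H)) \<le> K * (1/2 + \<epsilon> * (3/4))"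
      by (intro mult_left_mono) auto
    \<comment> \<open>The learner loses at least \<epsilon>/4 per episode on average; with the
      factor 1/16 in \<epsilon> this gives the constant 1/64.\<close>
    with le have "K * \<epsilon> / 4 \<le> K * (1/2 + \<epsilon>) - (\<Sum>k=1..K. learner_value H 0 Ms \<A> k)"
      by (simp add: algebra_simps)
    also have "\<dots> = (\<Sum>k=1..K. policy_value H 0 (Ms k) (replay xs) - learner_value H 0 Ms \<A> k)"
      by (simp add: sum_subtractf val)
    finally have regret: "K * \<epsilon> / 4 \<le> \<dots>" .
    have "K * sqrt (2 ^ H / K) = sqrt (2 ^ H * real K)"
      using HK' by (simp add: real_sqrt_divide real_sqrt_mult field_simps)
    then have "K * min 1 (sqrt (2 ^ H / K)) = min (sqrt (2 ^ H * real K)) (real K)"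
      using HK' by (simp add: min_mult_distrib_left min.commute)
    then have "1/64 * min (sqrt (2 ^ H * real K)) (real K) = K * \<epsilon> / 4"
      by (simp add: \<epsilon>_def)
    with regret have "ereal (1/64 * min (sqrt (2 ^ H * real K)) (real K)) \<le>
        ereal (\<Sum>k=1..K. policy_value H 0 (Ms k) (replay xs) - learner_value H 0 Ms \<A> k)"
      by (simp only: ereal_less_eq)
    with pol show ?thesis
      by (intro SUP_upper2[OF Ms_in] SUP_upper2[of "replay xs"]) auto
  qed
  then show "\<exists>S A s0 \<M>.
      (\<forall>h\<in>{1..H}. finite (S h) \<and> S h \<noteq> {} \<and> card (S h) \<le> 2) \<and>
      (\<forall>h\<in>{1..H}. finite (A h) \<and> A h \<noteq> {} \<and> card (A h) \<le> 2) \<and>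
      (s0 :: nat) \<in> S 1 \<and>
      (\<forall>M\<in>\<M>. is_mdp H S A M) \<and>
      (\<forall>\<A> :: (nat, nat) det_algorithm measure. is_algorithm H S A \<A> \<longrightarrow>
        (SUP Ms \<in> {1..K} \<rightarrow> \<M>. SUP \<mu> \<in> {\<mu>. is_policy H S A \<mu>}.
           ereal (\<Sum>k=1..K. policy_value H s0 (Ms k) \<mu> - learner_value H s0 Ms \<A> k))
        \<ge> ereal (1/64 * min (sqrt (2 ^ H * real K)) (real K)))"
    by (intro exI[of _ B] exI[of _ 0] exI[of _ \<M>]) (auto simp: B_def \<M>_def)
qed simp

end
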